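(* Let $p$ be an odd prime, let $n=m=p$, and let $\delta$ be the multiplicative order of $2$ modulo $p$. Then there are exactly three distinct values of $\mathrm{Per}(\mathbf{u})$ for $\mathbf{u}\in\mathbb{Z}_p^p$, namely: (1) $\mathrm{Per}(\mathbf{u})=1$, which can only happen when $\mathbf{u}=(0,0,\dots,0)$; (2) $\mathrm{Per}(\mathbf{u})=\delta$, which can only happen if $\mathbf{u}=(x,x,\dots,x)$ for some $x\in\mathbb{Z}_p$; (3) $\mathrm{Per}(\mathbf{u})=P_p(p)=p\cdot\delta$.
   Context: $\mathbb{Z}_m=\mathbb{Z}/m\mathbb{Z}$. The Ducci function $D:\mathbb{Z}_m^n\to\mathbb{Z}_m^n$ is $D(x_1,x_2,\dots,x_n)=(x_1+x_2,\;x_2+x_3,\;\dots,\;x_n+x_1)$ (entries reduced mod $m$). $\mathrm{Per}(\mathbf{u})$, the period of $\mathbf{u}$, is the smallest integer $\beta\ge 1$ such that $D^{\alpha+\beta}(\mathbf{u})=D^{\alpha}(\mathbf{u})$ for some integer $\alpha\ge 0$. $P_m(n)=\mathrm{Per}(0,0,\dots,0,1)$ for the tuple $(0,0,\dots,0,1)\in\mathbb{Z}_m^n$. *)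

theory Defs
  imports "HOL-Number_Theory.Number_Theory"
begin

(* An n-tuple over Z/mZ is a list of length n of the representatives 0, ..., m - 1.
   All notions are meant for m \<ge> 1 and n \<ge> 1. *)

definition ducci_tuples :: "nat \<Rightarrow> nat \<Rightarrow> int list set" where
  "ducci_tuples m n = {u. length u = n \<and> set u \<subseteq> carrier (residue_ring (int m))}"

(* rotate1 [x1, ..., xn] = [x2, ..., xn, x1] *)
definition ducci :: "nat \<Rightarrow> int list \<Rightarrow> int list" where
  "ducci m u = map2 (\<lambda>x y. x \<oplus>\<^bsub>residue_ring (int m)\<^esub> y) u (rotate1 u)"

definition ducci_per :: "nat \<Rightarrow> int list \<Rightarrow> nat" where
  "ducci_per m u =
     (LEAST b. 1 \<le> b \<and> (\<exists>a. (ducci m ^^ (a + b)) u = (ducci m ^^ a) u))"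

(* "1 mod m" rather than "1" only so that the entry is a representative also for m = 1. *)
definition basic_tuple :: "nat \<Rightarrow> nat \<Rightarrow> int list" where
  "basic_tuple m n = replicate (n - 1) 0 @ [1 mod int m]"

definition ducci_P :: "nat \<Rightarrow> nat \<Rightarrow> nat" where
  "ducci_P m n = ducci_per m (basic_tuple m n)"

lemma length_ducci [simp]: "length (ducci m u) = length u"
  by (simp add: ducci_def)

lemma ducci_nth:
  "i < length u \<Longrightarrow> ducci m u ! i = (u ! i + u ! (Suc i mod length u)) mod int m"
  by (simp add: ducci_def residue_ring_def nth_rotate1)

lemma ducci_in_tuples:
  assumes "m > 0" "u \<in> ducci_tuples m n"
  shows "ducci m u \<in> ducci_tuples m n"
  using assms by (auto simp: ducci_tuples_def residue_ring_def in_set_conv_nth ducci_nth)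

lemma basic_tuple_in_tuples: "m > 0 \<Longrightarrow> n > 0 \<Longrightarrow> basic_tuple m n \<in> ducci_tuples m n"
  by (auto simp: ducci_tuples_def basic_tuple_def residue_ring_def)

end

theory Submission
  imports Defs
begin

text \<open>
  Write \<open>S\<close> for the cyclic shift, so that the Ducci map is \<open>D = 1 + S\<close> on the tuples of length
  \<open>p\<close> over the field with \<open>p\<close> elements. There the Frobenius identity gives
  \<open>D\<^sup>p = 1 + S\<^sup>p = 2\<close>: \<open>p\<close> Ducci steps double the tuple (\<open>ducci_funpow_prime\<close>). Everything
  follows from this identity. Let \<open>\<delta>\<close> be the order of 2 modulo \<open>p\<close>.

  \<^item> As \<open>D\<^bsup>p\<delta>\<^esup> = 2\<^bsup>\<delta>\<^esup> = 1\<close>, every tuple is purely periodic and its period divides \<open>p\<delta>\<close>.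

  \<^item> If \<open>D\<^sup>b u = u\<close> with \<open>u \<noteq> 0\<close>, then \<open>u = D\<^bsup>pb\<^esup> u = 2\<^sup>b u\<close>, so \<open>\<delta>\<close> divides \<open>b\<close>. Since \<open>p\<close> is
  prime, the period of a nonzero tuple is therefore \<open>\<delta>\<close> or \<open>p\<delta>\<close>.

  \<^item> If the period is \<open>\<delta>\<close>, then \<open>D\<^bsup>p-1\<^esup> u = u\<close> because \<open>\<delta>\<close> divides \<open>p - 1\<close>; hence
  \<open>D u = D\<^sup>p u = 2 u\<close>, that is, \<open>u\<^sub>i + u\<^sub>i\<^sub>+\<^sub>1 = 2 u\<^sub>i\<close> for every \<open>i\<close>, and \<open>u\<close> is constant.
  Conversely \<open>D\<close> doubles constant tuples, so the nonzero ones have period \<open>\<delta>\<close>.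

  The tuple \<open>(0, \<dots>, 0, 1)\<close> is not constant and so has period \<open>p\<delta>\<close>. The three values differ because
  2 is not 1 modulo \<open>p\<close>.
\<close>

section \<open>Iterates of the Ducci map\<close>

lemma length_funpow_ducci [simp]: "length ((ducci m ^^ k) u) = length u"
  by (induction k) auto

lemma ducci_tuples_nth:
  "u \<in> ducci_tuples m n \<Longrightarrow> i < n \<Longrightarrow> 0 \<le> u ! i \<and> u ! i < int m"
  by (force simp: ducci_tuples_def residue_ring_def subset_iff in_set_conv_nth)

lemma funpow_ducci_in_tuples:
  "m > 0 \<Longrightarrow> u \<in> ducci_tuples m n \<Longrightarrow> (ducci m ^^ k) u \<in> ducci_tuples m n"
  by (induction k) (auto intro: ducci_in_tuples)

text \<open>This is the binomial expansion of \<open>(1 + S)\<^sup>k\<close> for the cyclic shift \<open>S\<close>.\<close>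

lemma ducci_funpow_nth_cong:
  assumes "i < length u"
  shows "[(ducci m ^^ k) u ! i = (\<Sum>j\<le>k. int (k choose j) * u ! ((i + j) mod length u))] (mod int m)"
  using assms
proof (induction k arbitrary: i)
  case 0
  then show ?case by simp
next
  case (Suc k)
  let ?n = "length u"
  let ?a = "\<lambda>j. u ! ((i + j) mod ?n)"
  let ?F = "\<lambda>i. \<Sum>j\<le>k. int (k choose j) * u ! ((i + j) mod ?n)"
  have n: "Suc i mod ?n < ?n"
    using Suc.prems by (intro mod_less_divisor) linarith
  have "[(ducci m ^^ Suc k) u ! i
      = (ducci m ^^ k) u ! i + (ducci m ^^ k) u ! (Suc i mod ?n)] (mod int m)"
    using Suc.prems by (simp add: ducci_nth)
  also have "[(ducci m ^^ k) u ! i + (ducci m ^^ k) u ! (Suc i mod ?n)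
      = ?F i + ?F (Suc i mod ?n)] (mod int m)"
    using Suc.IH[OF Suc.prems] Suc.IH[OF n] by (rule cong_add)
  also have "?F (Suc i mod ?n) = (\<Sum>j\<le>k. int (k choose j) * ?a (Suc j))"
    by (simp add: mod_simps)
  also have "?F i + (\<Sum>j\<le>k. int (k choose j) * ?a (Suc j))
      = (\<Sum>j\<le>Suc k. int (Suc k choose j) * ?a j)"
  proof -
    have "?F i = (\<Sum>j\<le>Suc k. int (k choose j) * ?a j)"
      by simp
    also have "\<dots> = ?a 0 + (\<Sum>j\<le>k. int (k choose Suc j) * ?a (Suc j))"
      by (subst sum.atMost_Suc_shift) simp
    finally show ?thesis
      by (subst sum.atMost_Suc_shift) (simp add: algebra_simps sum.distrib)
  qed
  finally show ?case .
qed

text \<open>The binomial coefficients strictly between the two ends vanish modulo \<open>p\<close>, and the two ends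
  both contribute the entry itself since a shift by the length \<open>p\<close> is the identity.\<close>

lemma ducci_funpow_prime:
  assumes "prime p" and u: "u \<in> ducci_tuples p p"
  shows "(ducci p ^^ p) u = map (\<lambda>x. 2 * x mod int p) u"
proof (rule nth_equalityI)
  show "length ((ducci p ^^ p) u) = length (map (\<lambda>x. 2 * x mod int p) u)"
    by simp
next
  fix i assume "i < length ((ducci p ^^ p) u)"
  moreover have len: "length u = p"
    using u by (simp add: ducci_tuples_def)
  ultimately have i: "i < p" by simp
  let ?t = "\<lambda>j. int (p choose j) * u ! ((i + j) mod p)"
  have p: "p > 0" "p \<ge> 2"
    using assms(1) by (simp_all add: prime_gt_0_nat prime_ge_2_nat)
  have mid: "int p dvd ?t j" if "j \<in> {..p} - {0, p}" for j
  proof -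
    have "p dvd p choose j"
      using that assms(1) by (intro dvd_choose_prime) auto
    then show ?thesis
      by (intro dvd_mult2) (simp only: int_dvd_int_iff)
  qed
  have "(\<Sum>j\<le>p. ?t j) = (\<Sum>j\<in>{0, p}. ?t j) + (\<Sum>j\<in>{..p} - {0, p}. ?t j)"
    by (subst add.commute, rule sum.subset_diff) auto
  also have "[\<dots> = (\<Sum>j\<in>{0, p}. ?t j) + 0] (mod int p)"
    using dvd_sum[of "{..p} - {0, p}" "int p" ?t] mid
    by (intro cong_add cong_refl) (simp add: cong_0_iff)
  also have "(\<Sum>j\<in>{0, p}. ?t j) + 0 = 2 * u ! i"
    using p i by simp
  finally have "[(\<Sum>j\<le>p. ?t j) = 2 * u ! i] (mod int p)" .
  moreover have "[(ducci p ^^ p) u ! i = (\<Sum>j\<le>p. ?t j)] (mod int p)"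
    using ducci_funpow_nth_cong[of i u p p] i len by simp
  ultimately have "[(ducci p ^^ p) u ! i = 2 * u ! i] (mod int p)"
    by (rule cong_trans[rotated])
  moreover have "(ducci p ^^ p) u ! i mod int p = (ducci p ^^ p) u ! i"
    using ducci_tuples_nth[OF funpow_ducci_in_tuples[OF p(1) u, of p] i] by simp
  ultimately show "(ducci p ^^ p) u ! i = map (\<lambda>x. 2 * x mod int p) u ! i"
    using i len by (simp add: cong_def)
qed

lemma ducci_funpow_prime_mult:
  assumes "prime p" and u: "u \<in> ducci_tuples p p"
  shows "(ducci p ^^ (p * k)) u = map (\<lambda>x. 2 ^ k * x mod int p) u"
proof (induction k)
  case 0
  have "x mod int p = x" if "x \<in> set u" for x
    using u that by (auto simp: ducci_tuples_def residue_ring_def)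
  then show ?case
    by (simp add: map_idI)
next
  case (Suc k)
  have "(ducci p ^^ (p * Suc k)) u = (ducci p ^^ p) ((ducci p ^^ (p * k)) u)"
    by (simp add: funpow_add)
  also have "\<dots> = map (\<lambda>x. 2 * x mod int p) ((ducci p ^^ (p * k)) u)"
    using assms by (intro ducci_funpow_prime funpow_ducci_in_tuples prime_gt_0_nat)
  also have "\<dots> = map (\<lambda>x. 2 ^ Suc k * x mod int p) u"
    by (simp add: Suc.IH mod_simps mult.assoc)
  finally show ?case .
qed

lemma ducci_funpow_replicate:
  assumes "0 \<le> x" "x < int m"
  shows "(ducci m ^^ k) (replicate n x) = replicate n (2 ^ k * x mod int m)"
proof (induction k)
  case 0
  then show ?case using assms by simp
next
  case (Suc k)
  have "ducci m (replicate n y) = replicate n (2 * y mod int m)" for y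
    by (intro nth_equalityI) (simp_all add: ducci_nth)
  then show ?case
    by (simp add: Suc.IH mod_simps mult.assoc)
qed

section \<open>Periods of purely periodic tuples\<close>

text \<open>If some positive iterate fixes \<open>u\<close>, then \<open>u\<close> lies on its own cycle, so the pre-period in the
  definition of the period can be dropped.\<close>

lemma funpow_fixed_of_eventually_periodic:
  fixes f :: "'a \<Rightarrow> 'a"
  assumes "(f ^^ N) u = u" "N > 0" and eq: "(f ^^ (a + b)) u = (f ^^ a) u"
  shows "(f ^^ b) u = u"
proof -
  have fix_mult: "(f ^^ (N * a)) u = u"
    using funpow_mod_eq[OF assms(1), of "N * a"] by simp
  have "a \<le> N * a"
    using \<open>N > 0\<close> by simp
  \<comment> \<open>Completing \<open>a\<close> steps to a multiple of \<open>N\<close> returns to \<open>u\<close>.\<close>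
  then obtain c where c: "N * a = c + a"
    by (metis le_add_diff_inverse2)
  have "(f ^^ b) u = (f ^^ b) ((f ^^ (N * a)) u)"
    by (simp only: fix_mult)
  also have "\<dots> = (f ^^ (c + (a + b))) u"
    unfolding c by (metis add.assoc add.commute comp_apply funpow_add)
  also have "\<dots> = (f ^^ (c + a)) u"
    by (simp only: funpow_add comp_apply eq[unfolded funpow_add comp_apply])
  also have "\<dots> = u"
    by (simp only: c[symmetric] fix_mult)
  finally show ?thesis .
qed

lemma ducci_per_dvd_iff:
  assumes "(ducci m ^^ N) u = u" "N > 0"
  shows "(ducci m ^^ c) u = u \<longleftrightarrow> ducci_per m u dvd c"
proof -
  let ?b = "ducci_per m u"
  have per: "?b = (LEAST b. 1 \<le> b \<and> (ducci m ^^ b) u = u)"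
  proof -
    have "(\<exists>a. (ducci m ^^ (a + b)) u = (ducci m ^^ a) u) \<longleftrightarrow> (ducci m ^^ b) u = u" for b
    proof
      assume "\<exists>a. (ducci m ^^ (a + b)) u = (ducci m ^^ a) u"
      then obtain a where "(ducci m ^^ (a + b)) u = (ducci m ^^ a) u" ..
      then show "(ducci m ^^ b) u = u"
        by (rule funpow_fixed_of_eventually_periodic[OF assms])
    next
      assume "(ducci m ^^ b) u = u"
      then have "(ducci m ^^ (0 + b)) u = (ducci m ^^ 0) u" by simp
      then show "\<exists>a. (ducci m ^^ (a + b)) u = (ducci m ^^ a) u" ..
    qed
    then show ?thesis by (simp only: ducci_per_def)
  qed
  have b: "1 \<le> ?b" "(ducci m ^^ ?b) u = u"
    using LeastI[of "\<lambda>b. 1 \<le> b \<and> (ducci m ^^ b) u = u" N] assms unfolding per by auto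
  have "?b dvd c" if "(ducci m ^^ c) u = u"
  proof (rule ccontr)
    assume "\<not> ?b dvd c"
    then have "1 \<le> c mod ?b" by (simp add: dvd_eq_mod_eq_0)
    moreover have "(ducci m ^^ (c mod ?b)) u = u"
      using funpow_mod_eq[OF b(2), of c] that by simp
    ultimately have "?b \<le> c mod ?b"
      unfolding per by (intro Least_le) simp
    then show False
      using b(1) mod_less_divisor[of ?b c] by linarith
  qed
  moreover have "(ducci m ^^ c) u = u" if "?b dvd c"
    using funpow_mod_eq[OF b(2), of c] that by simp
  ultimately show ?thesis by blast
qed

section \<open>Periods of tuples of prime length\<close>

lemma ord_2_odd_prime:
  assumes "prime p" "odd p"
  shows "ord p 2 > 1" "ord p 2 dvd p - 1"
proof -
  have p: "p > 2" and "\<not> p dvd 2"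
    using assms prime_ge_2_nat[of p] by (auto simp: le_less dest: dvd_imp_le)
  then have cop: "coprime p 2"
    using assms(2) by simp
  have "ord p 2 \<noteq> 1"
    using ord[of 2 p] p by (auto simp: cong_def)
  moreover have "ord p 2 > 0"
    using cop by simp
  ultimately show "ord p 2 > 1" by linarith
  show "ord p 2 dvd p - 1"
    using fermat_theorem[OF assms(1) \<open>\<not> p dvd 2\<close>] by (simp only: ord_divides)
qed

lemma two_power_ord_mult_mod:
  fixes x :: int
  assumes "0 \<le> x" "x < int p"
  shows "2 ^ ord p 2 * x mod int p = x"
proof -
  have "[int (2 ^ ord p 2) = int 1] (mod int p)"
    using ord[of 2 p] by (simp only: cong_int_iff)
  then have "[2 ^ ord p 2 * x = 1 * x] (mod int p)"
    by (intro cong_mult) simp_all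
  then show ?thesis
    using assms by (simp add: cong_def)
qed

lemma ducci_funpow_prime_ord:
  assumes "prime p" and u: "u \<in> ducci_tuples p p"
  shows "(ducci p ^^ (p * ord p 2)) u = u"
proof -
  have "2 ^ ord p 2 * x mod int p = x" if "x \<in> set u" for x
    using u that by (intro two_power_ord_mult_mod) (auto simp: ducci_tuples_def residue_ring_def)
  then show ?thesis
    by (simp add: ducci_funpow_prime_mult[OF assms] map_idI)
qed

text \<open>A tuple fixed by \<open>b\<close> steps is fixed by \<open>p b\<close> steps, which multiply by \<open>2\<^sup>b\<close>; cancelling a
  nonzero entry modulo \<open>p\<close> leaves \<open>2\<^sup>b = 1\<close>.\<close>

lemma ord_dvd_of_ducci_fixed:
  assumes "prime p" and u: "u \<in> ducci_tuples p p" "u \<noteq> replicate p 0"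
    and fixed: "(ducci p ^^ b) u = u"
  shows "ord p 2 dvd b"
proof -
  have "\<exists>x\<in>set u. x \<noteq> 0"
    using u replicate_length_same[of u 0] by (auto simp: ducci_tuples_def)
  then obtain x where x: "x \<in> set u" "x \<noteq> 0" by blast
  then have range: "0 < x" "x < int p"
    using u(1) by (auto simp: ducci_tuples_def residue_ring_def)
  have "(ducci p ^^ (p * b)) u = u"
    using funpow_mod_eq[OF fixed, of "p * b"] by simp
  then have "map (\<lambda>x. 2 ^ b * x mod int p) u = u"
    by (simp add: ducci_funpow_prime_mult[OF assms(1) u(1)])
  then have "2 ^ b * x mod int p = x"
    using x(1) by (metis map_eq_conv list.map_id id_apply)
  then have "[2 ^ b * x = 1 * x] (mod int p)"
    using range by (simp add: cong_def)
  moreover have "coprime x (int p)"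
    using assms(1) range zdvd_not_zless[OF range]
    by (metis coprime_commute prime_imp_coprime prime_nat_int_transfer)
  ultimately have "[2 ^ b = (1::int)] (mod int p)"
    by (simp only: cong_mult_rcancel)
  then have "[2 ^ b = (1::nat)] (mod p)"
    using cong_int_iff[of "2 ^ b" 1 p] by simp
  then show ?thesis
    by (simp only: ord_divides)
qed

lemma ducci_per_zero:
  assumes "prime p"
  shows "ducci_per p (replicate p 0) = 1"
proof -
  have f: "(ducci p ^^ 1) (replicate p 0) = replicate p 0"
    using ducci_funpow_replicate[of 0 p 1 p] assms by (simp add: prime_gt_0_nat)
  show ?thesis
    using ducci_per_dvd_iff[OF f, of 1] f by simp
qed

lemma ducci_per_replicate:
  assumes "prime p" "odd p" "0 < x" "x < int p"
  shows "ducci_per p (replicate p x) = ord p 2"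
proof (rule dvd_antisym)
  have p: "p > 0" using assms(1) by (rule prime_gt_0_nat)
  have u: "replicate p x \<in> ducci_tuples p p" "replicate p x \<noteq> replicate p 0"
    using assms p by (auto simp: ducci_tuples_def residue_ring_def)
  have f: "(ducci p ^^ ord p 2) (replicate p x) = replicate p x"
    using assms by (simp add: ducci_funpow_replicate two_power_ord_mult_mod)
  have "ord p 2 > 0"
    using ord_2_odd_prime(1)[OF assms(1,2)] by linarith
  note dvd_iff = ducci_per_dvd_iff[OF f this]
  show "ord p 2 dvd ducci_per p (replicate p x)"
    by (rule ord_dvd_of_ducci_fixed[OF assms(1) u iffD2[OF dvd_iff dvd_refl]])
  show "ducci_per p (replicate p x) dvd ord p 2"
    by (rule iffD1[OF dvd_iff f])
qed

text \<open>Since \<open>\<delta>\<close> divides \<open>p - 1\<close>, a tuple \<open>u\<close> fixed by \<open>\<delta>\<close> steps satisfies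
  \<open>D u = D\<^sup>p u = 2 u\<close>, which compares neighbouring entries.\<close>

lemma constant_of_ducci_fixed_ord:
  assumes "prime p" "odd p" and u: "u \<in> ducci_tuples p p"
    and fixed: "(ducci p ^^ ord p 2) u = u"
  shows "\<exists>x \<in> carrier (residue_ring (int p)). u = replicate p x"
proof -
  have len: "length u = p"
    using u by (simp add: ducci_tuples_def)
  have p: "p > 0" using assms(1) by (rule prime_gt_0_nat)
  have "(ducci p ^^ (p - 1)) u = u"
    using funpow_mod_eq[OF fixed, of "p - 1"] ord_2_odd_prime(2)[OF assms(1,2)] by simp
  moreover have "(ducci p ^^ p) u = ducci p ((ducci p ^^ (p - 1)) u)"
    using p by (metis Suc_diff_1 comp_apply funpow.simps(2))
  ultimately have double: "ducci p u = map (\<lambda>x. 2 * x mod int p) u"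
    using ducci_funpow_prime[OF assms(1) u] by simp
  have step: "u ! Suc i = u ! i" if "Suc i < p" for i
  proof -
    have "[u ! i + u ! Suc i = u ! i + u ! i] (mod int p)"
      using arg_cong[OF double, of "\<lambda>v. v ! i"] that len by (simp add: ducci_nth cong_def)
    then have "[u ! Suc i = u ! i] (mod int p)"
      by (simp only: cong_add_lcancel)
    then show ?thesis
      using ducci_tuples_nth[OF u, of i] ducci_tuples_nth[OF u, of "Suc i"] that
      by (simp add: cong_def)
  qed
  have const: "u ! i = u ! 0" if "i < p" for i
    using that
  proof (induction i)
    case (Suc i)
    then show ?case using step[of i] by simp
  qed simp
  have "u = replicate p (u ! 0)"
  proof (rule nth_equalityI)
    fix i assume "i < length u"
    then show "u ! i = replicate p (u ! 0) ! i"
      using const[of i] len by (simp only: nth_replicate)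
  qed (simp add: len)
  moreover have "u ! 0 \<in> carrier (residue_ring (int p))"
    using ducci_tuples_nth[OF u p] by (simp add: residue_ring_def)
  ultimately show ?thesis by blast
qed

lemma ducci_per_nonconstant:
  assumes "prime p" "odd p" and u: "u \<in> ducci_tuples p p"
    and nonconst: "\<not> (\<exists>x \<in> carrier (residue_ring (int p)). u = replicate p x)"
  shows "ducci_per p u = p * ord p 2"
proof -
  have p: "p > 0" using assms(1) by (rule prime_gt_0_nat)
  have "p * ord p 2 > 0"
    using p ord_2_odd_prime(1)[OF assms(1,2)] by (intro mult_pos_pos) linarith+
  note dvd_iff = ducci_per_dvd_iff[OF ducci_funpow_prime_ord[OF assms(1) u] this]
  have "u \<noteq> replicate p 0"
    using nonconst p by (auto simp: residue_ring_def)
  then have "ord p 2 dvd ducci_per p u"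
    by (rule ord_dvd_of_ducci_fixed[OF assms(1) u _ iffD2[OF dvd_iff dvd_refl]])
  then obtain k where k: "ducci_per p u = ord p 2 * k" by (rule dvdE)
  have "ducci_per p u dvd ord p 2 * p"
    using iffD1[OF dvd_iff ducci_funpow_prime_ord[OF assms(1) u]] by (simp only: mult.commute)
  then have "k dvd p"
    using ord_2_odd_prime(1)[OF assms(1,2)] by (simp add: k)
  moreover have "k \<noteq> 1"
    using constant_of_ducci_fixed_ord[OF assms(1-3) iffD2[OF dvd_iff]] nonconst k by auto
  ultimately have "k = p"
    using assms(1) by (auto simp: prime_nat_iff)
  then show ?thesis by (simp add: k mult.commute)
qed

lemma basic_tuple_nonconstant:
  assumes "m > 1" "n > 1"
  shows "basic_tuple m n \<noteq> replicate n x"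
proof
  assume "basic_tuple m n = replicate n x"
  moreover have "basic_tuple m n ! 0 = 0" "basic_tuple m n ! (n - 1) = 1"
    using assms by (simp_all add: basic_tuple_def nth_append)
  ultimately show False
    using assms by simp
qed

theorem theorem4:
  fixes p \<delta> :: nat
  assumes "prime p" and "odd p"
    and "\<delta> = ord p 2"
  shows "card (ducci_per p ` ducci_tuples p p) = 3
    \<and> ducci_per p ` ducci_tuples p p = {1, \<delta>, ducci_P p p}
    \<and> (\<forall>u \<in> ducci_tuples p p. ducci_per p u = 1 \<longrightarrow> u = replicate p 0)
    \<and> (\<forall>u \<in> ducci_tuples p p. ducci_per p u = \<delta> \<longrightarrow>
          (\<exists>x \<in> carrier (residue_ring (int p)). u = replicate p x))
    \<and> ducci_P p p = p * \<delta>"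
proof -
  let ?T = "ducci_tuples p p"
  have p: "p > 1" using assms(1) by (rule prime_gt_1_nat)
  have \<delta>: "\<delta> > 1"
    using ord_2_odd_prime(1)[OF assms(1,2)] assms(3) by simp
  have basic: "basic_tuple p p \<in> ?T"
    using p by (intro basic_tuple_in_tuples) auto
  have P: "ducci_P p p = p * \<delta>"
    using ducci_per_nonconstant[OF assms(1,2) basic] basic_tuple_nonconstant[OF p p] assms(3)
    by (simp add: ducci_P_def)
  have distinct: "\<delta> \<noteq> 1" "p * \<delta> \<noteq> 1" "p * \<delta> \<noteq> \<delta>"
    using p \<delta> by auto
  have const: "ducci_per p (replicate p x) = (if x = 0 then 1 else \<delta>)"
    if "x \<in> carrier (residue_ring (int p))" for x
    using that ducci_per_zero[OF assms(1)] ducci_per_replicate[OF assms(1,2), of x] assms(3)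
    by (auto simp: residue_ring_def)
  have nonconst: "ducci_per p u = p * \<delta>"
    if "u \<in> ?T" "\<not> (\<exists>x \<in> carrier (residue_ring (int p)). u = replicate p x)" for u
    using ducci_per_nonconstant[OF assms(1,2) that] assms(3) by simp
  have one: "u = replicate p 0" if "u \<in> ?T" "ducci_per p u = 1" for u
    using that const nonconst distinct by metis
  have delta: "\<exists>x \<in> carrier (residue_ring (int p)). u = replicate p x"
    if "u \<in> ?T" "ducci_per p u = \<delta>" for u
    using that nonconst distinct by metis
  have image: "ducci_per p ` ?T = {1, \<delta>, ducci_P p p}"
  proof
    show "ducci_per p ` ?T \<subseteq> {1, \<delta>, ducci_P p p}"
      using const nonconst P by (smt (verit) image_subsetI insert_iff)
    have "replicate p 0 \<in> ?T" "replicate p 1 \<in> ?T"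
      using p by (auto simp: ducci_tuples_def residue_ring_def)
    moreover have "ducci_per p (replicate p 0) = 1" "ducci_per p (replicate p 1) = \<delta>"
      using const[of 0] const[of 1] p by (simp_all add: residue_ring_def)
    ultimately show "{1, \<delta>, ducci_P p p} \<subseteq> ducci_per p ` ?T"
      using basic unfolding ducci_P_def by (metis image_eqI insert_subset empty_subsetI)
  qed
  have "card {1, \<delta>, ducci_P p p} = 3"
    using distinct by (simp add: P)
  then show ?thesis
    using image one delta P by metis
qed

end
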